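(* Let $\lambda_1,\lambda_2,a,b,c,d\in\mathbb{R}$ and let $$A=\begin{bmatrix}\lambda_1&0\\0&\lambda_2\end{bmatrix},\qquad B=\begin{bmatrix}a&b\\c&d\end{bmatrix}.$$ If $bc\ge 0$, then $\{A,B\}$ has the spectral finiteness property. More precisely, if $bc\ge 0$, then the generalized spectral radius $\boldsymbol{\rho}$ of $\{A,B\}$ satisfies $\boldsymbol{\rho}=\max\{\rho(A),\rho(B)\}$.
   Context: For a square matrix $M$, $\rho(M)$ denotes its usual spectral radius (the maximum modulus of its complex eigenvalues). For a finite set $\boldsymbol{A}$ of real square matrices of the same size and $n\ge 1$, put $\boldsymbol{A}^n=\{M_1\cdots M_n : M_i\in\boldsymbol{A}\text{ for }1\le i\le n\}$. The generalized spectral radius of $\boldsymbol{A}$ is $$\boldsymbol{\rho}=\sup_{n\ge 1}\max_{M\in\boldsymbol{A}^n}\sqrt[n]{\rho(M)}.$$ The set $\boldsymbol{A}$ has the spectral finiteness property if there exist some $n\ge 1$ and some $M\in\boldsymbol{A}^n$ such that $\boldsymbol{\rho}=\sqrt[n]{\rho(M)}$. *)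

theory Defs
  imports "Jordan_Normal_Form.Spectral_Radius"
begin

definition real_spectral_radius :: "real mat \<Rightarrow> real" where
  "real_spectral_radius M = spectral_radius (map_mat complex_of_real M)"

text \<open>The matrix type carries no global unit, so the common size \<open>k\<close> of the matrices in \<open>S\<close>
  is a parameter here and below.\<close>

definition mat_products :: "nat \<Rightarrow> real mat set \<Rightarrow> nat \<Rightarrow> real mat set" where
  "mat_products k S n = {foldr (*) Ms (1\<^sub>m k) | Ms. length Ms = n \<and> set Ms \<subseteq> S}"

text \<open>Intended for finite nonempty \<open>S \<subseteq> carrier_mat k k\<close> with \<open>k > 0\<close>. Every maximum is then over
  a finite nonempty set, and the supremum is over a set bounded above by
  \<open>k * C\<close> for any bound \<open>C\<close> on the moduli of the entries of the matrices in \<open>S\<close>.\<close>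

definition generalized_spectral_radius :: "nat \<Rightarrow> real mat set \<Rightarrow> real" where
  "generalized_spectral_radius k S =
     (SUP n\<in>{1..}. Max ((\<lambda>M. root n (real_spectral_radius M)) ` mat_products k S n))"

definition spectral_finiteness_property :: "nat \<Rightarrow> real mat set \<Rightarrow> bool" where
  "spectral_finiteness_property k S \<longleftrightarrow>
     (\<exists>n\<ge>1. \<exists>M\<in>mat_products k S n.
        generalized_spectral_radius k S = root n (real_spectral_radius M))"

end

theory Submission
  imports Defs
begin

text \<open>If \<open>b c > 0\<close>, the diagonal scaling that makes \<open>B\<close> symmetric leaves the diagonal matrix \<open>A\<close>
  unchanged. So in the norm given by \<open>\<bar>c\<bar> x\<^sup>2 + \<bar>b\<bar> y\<^sup>2\<close> both operator norms equal the spectral radii,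
  and submultiplicativity bounds the spectral radius of every product of length \<open>n\<close> by
  \<open>max (\<rho> A) (\<rho> B) ^ n\<close>. If \<open>b c = 0\<close>, then \<open>A\<close> and \<open>B\<close> are simultaneously triangular, and the
  same bound follows because diagonal entries multiply.\<close>

section \<open>The spectral radius as the largest modulus of an eigenvalue\<close>

lemma real_spectral_radius_attained:
  assumes "M \<in> carrier_mat n n" and "n > 0"
  obtains e where "eigenvalue (map_mat complex_of_real M) e" and "cmod e = real_spectral_radius M"
proof -
  have "map_mat complex_of_real M \<in> carrier_mat n n"
    using assms by simp
  from spectral_radius_mem_max(1)[OF this assms(2)] show ?thesis
    using that unfolding real_spectral_radius_def spectrum_def by auto
qed

lemma cmod_eigenvalue_le_real_spectral_radius:
  assumes "M \<in> carrier_mat n n" and "n > 0" and "eigenvalue (map_mat complex_of_real M) e"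
  shows "cmod e \<le> real_spectral_radius M"
proof -
  have "map_mat complex_of_real M \<in> carrier_mat n n"
    using assms by simp
  from spectral_radius_mem_max(2)[OF this assms(2)] assms(3) show ?thesis
    unfolding real_spectral_radius_def spectrum_def by auto
qed

section \<open>Products of length \<open>n\<close> and the generalized spectral radius\<close>

lemma mat_products_carrier:
  assumes "S \<subseteq> carrier_mat k k" and "M \<in> mat_products k S n"
  shows "M \<in> carrier_mat k k"
proof -
  have "set Ms \<subseteq> S \<Longrightarrow> foldr (*) Ms (1\<^sub>m k) \<in> carrier_mat k k" for Ms
    using assms(1) by (induction Ms) auto
  with assms(2) show ?thesis
    unfolding mat_products_def by auto
qed

lemma mat_products_0 [simp]: "mat_products k S 0 = {1\<^sub>m k}"
  unfolding mat_products_def by auto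

lemma mat_products_Suc:
  "mat_products k S (Suc n) = {M * N | M N. M \<in> S \<and> N \<in> mat_products k S n}"
proof (intro Set.set_eqI iffI)
  fix P assume "P \<in> mat_products k S (Suc n)"
  then obtain Ms where "P = foldr (*) Ms (1\<^sub>m k)" "length Ms = Suc n" "set Ms \<subseteq> S"
    unfolding mat_products_def by auto
  then show "P \<in> {M * N | M N. M \<in> S \<and> N \<in> mat_products k S n}"
    unfolding mat_products_def by (cases Ms) auto
next
  fix P assume "P \<in> {M * N | M N. M \<in> S \<and> N \<in> mat_products k S n}"
  then obtain M Ms where "P = foldr (*) (M # Ms) (1\<^sub>m k)" "length (M # Ms) = Suc n" "set (M # Ms) \<subseteq> S"
    unfolding mat_products_def by auto
  then show "P \<in> mat_products k S (Suc n)"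
    unfolding mat_products_def by blast
qed

lemma mat_products_1:
  assumes "S \<subseteq> carrier_mat k k"
  shows "mat_products k S 1 = S"
  using assms by (force simp: mat_products_Suc)

lemma finite_mat_products:
  assumes "finite S"
  shows "finite (mat_products k S n)"
  by (induction n) (auto simp: mat_products_Suc assms finite_image_set2)

lemma mat_products_nonempty:
  assumes "S \<noteq> {}"
  shows "mat_products k S n \<noteq> {}"
  using assms by (induction n) (auto simp: mat_products_Suc)

text \<open>Reduces both claims to a bound on products: taking \<open>n\<close>-th roots in
  \<open>bound\<close> keeps every maximum below the spectral radius of \<open>G\<close>, and
  \<open>G\<close>, itself a product of length 1, attains it. \<open>nonneg\<close> makes
  \<open>root n\<close> undo the \<open>n\<close>-th power for even \<open>n\<close> too.\<close>

lemma spectral_finiteness_at_generator: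
  assumes S: "finite S" "S \<subseteq> carrier_mat k k" and "G \<in> S"
    and nonneg: "0 \<le> real_spectral_radius G"
    and bound: "\<And>n M. M \<in> mat_products k S n \<Longrightarrow>
      real_spectral_radius M \<le> real_spectral_radius G ^ n"
  shows "generalized_spectral_radius k S = real_spectral_radius G"
    and "spectral_finiteness_property k S"
proof -
  let ?r = "real_spectral_radius G"
  let ?m = "\<lambda>n. Max ((\<lambda>M. root n (real_spectral_radius M)) ` mat_products k S n)"
  have le: "?m n \<le> ?r" if "n \<ge> 1" for n
  proof -
    have "root n (real_spectral_radius M) \<le> ?r" if "M \<in> mat_products k S n" for M
    proof -
      have "root n (real_spectral_radius M) \<le> root n (?r ^ n)"
        using \<open>n \<ge> 1\<close> bound[OF that] by simp
      also have "\<dots> = ?r"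
        using \<open>n \<ge> 1\<close> nonneg by (simp add: real_root_power_cancel)
      finally show ?thesis .
    qed
    then show ?thesis
      using S(1) \<open>G \<in> S\<close> finite_mat_products[of S k n] mat_products_nonempty[of S k n]
      by (subst Max_le_iff) auto
  qed
  have G1: "G \<in> mat_products k S 1"
    using mat_products_1[OF S(2)] \<open>G \<in> S\<close> by simp
  then have "root 1 ?r \<le> ?m 1"
    using S(1) finite_mat_products by (intro Max_ge) auto
  with le[of 1] have "?m 1 = ?r"
    by simp
  then have "?r \<in> ?m ` {1..}"
    by (intro image_eqI[of _ _ 1]) auto
  then show "generalized_spectral_radius k S = ?r"
    unfolding generalized_spectral_radius_def using le by (intro cSup_eq_maximum) auto
  then show "spectral_finiteness_property k S"
    unfolding spectral_finiteness_property_def using G1 by (intro exI[of _ 1]) auto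
qed

section \<open>Eigenvalues of 2 x 2 matrices\<close>

lemma index_mult_mat_2:
  assumes "M \<in> carrier_mat 2 2" and "N \<in> carrier_mat 2 2" and "i < 2" and "j < 2"
  shows "(M * N) $$ (i, j) = M $$ (i, 0) * N $$ (0, j) + M $$ (i, 1) * N $$ (1, j)"
  using assms by (auto simp: scalar_prod_def numeral_2_eq_2)

lemma eigenvalue_2E:
  assumes "M \<in> carrier_mat 2 2" and "eigenvalue (map_mat complex_of_real M) e"
  obtains x y :: complex where "x \<noteq> 0 \<or> y \<noteq> 0"
    and "M $$ (0, 0) * x + M $$ (0, 1) * y = e * x"
    and "M $$ (1, 0) * x + M $$ (1, 1) * y = e * y"
proof -
  from assms obtain v where v: "v \<in> carrier_vec 2" "v \<noteq> 0\<^sub>v 2"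
    and ev: "map_mat complex_of_real M *\<^sub>v v = e \<cdot>\<^sub>v v"
    unfolding eigenvalue_def eigenvector_def by auto
  have row: "M $$ (i, 0) * v $ 0 + M $$ (i, 1) * v $ 1 = e * v $ i" if "i < 2" for i
    using arg_cong[OF ev, of "\<lambda>w. w $ i"] assms(1) v(1) that
    by (auto simp: scalar_prod_def numeral_2_eq_2)
  have "v $ 0 \<noteq> 0 \<or> v $ 1 \<noteq> 0"
    using v by (auto simp: vec_eq_iff less_2_cases_iff)
  then show ?thesis
    using that row[of 0] row[of 1] by simp
qed

text \<open>The hypothesis \<open>root\<close> says that the determinant of \<open>M - e I\<close>
  is zero; an eigenvector is then written down explicitly.\<close>

lemma eigenvalue_2I:
  fixes M :: "real mat" and e :: real
  assumes M: "M \<in> carrier_mat 2 2"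
    and root: "(M $$ (0, 0) - e) * (M $$ (1, 1) - e) = M $$ (0, 1) * M $$ (1, 0)"
  shows "eigenvalue (map_mat complex_of_real M) (complex_of_real e)"
proof -
  let ?M = "map_mat complex_of_real M"
  have ev: "eigenvalue ?M (complex_of_real e)" if xy: "x \<noteq> 0 \<or> y \<noteq> 0"
    and rows: "M $$ (0, 0) * x + M $$ (0, 1) * y = e * x" "M $$ (1, 0) * x + M $$ (1, 1) * y = e * y"
    for x y :: real
  proof -
    define v where "v = vec 2 (\<lambda>i. if i = 0 then complex_of_real x else complex_of_real y)"
    have v: "v \<in> carrier_vec 2" "v $ 0 = complex_of_real x" "v $ 1 = complex_of_real y"
      by (simp_all add: v_def)
    have "v \<noteq> 0\<^sub>v 2"
      using xy v(2,3) by auto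
    moreover have "?M *\<^sub>v v = complex_of_real e \<cdot>\<^sub>v v"
    proof (rule eq_vecI)
      fix i assume "i < dim_vec (complex_of_real e \<cdot>\<^sub>v v)"
      then have i: "i = 0 \<or> i = 1"
        using v(1) by auto
      have "(?M *\<^sub>v v) $ i = complex_of_real (M $$ (i, 0) * x + M $$ (i, 1) * y)"
        using i M v by (auto simp: scalar_prod_def numeral_2_eq_2)
      then show "(?M *\<^sub>v v) $ i = (complex_of_real e \<cdot>\<^sub>v v) $ i"
        using i rows v by (auto simp del: of_real_add simp flip: of_real_mult)
    qed (use M v(1) in auto)
    ultimately show ?thesis
      using M v(1) unfolding eigenvalue_def eigenvector_def by auto
  qed
  \<comment> \<open>The first row of \<open>M - e I\<close> annihilates
    \<open>(M $$ (0, 1), e - M $$ (0, 0))\<close> and the second annihilates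
    \<open>(e - M $$ (1, 1), M $$ (1, 0))\<close>; in each case \<open>root\<close> takes care of
    the other row. Both vectors vanish only if \<open>M = e I\<close>, where any nonzero vector will
    do.\<close>
  consider "M $$ (0, 1) \<noteq> 0 \<or> e \<noteq> M $$ (0, 0)" | "M $$ (1, 0) \<noteq> 0 \<or> e \<noteq> M $$ (1, 1)"
    | "M $$ (0, 1) = 0" "M $$ (1, 0) = 0" "e = M $$ (0, 0)" "e = M $$ (1, 1)"
    by blast
  then show ?thesis
  proof cases
    case 1
    have "M $$ (1, 0) * M $$ (0, 1) + M $$ (1, 1) * (e - M $$ (0, 0)) - e * (e - M $$ (0, 0))
        = M $$ (0, 1) * M $$ (1, 0) - (M $$ (0, 0) - e) * (M $$ (1, 1) - e)"
      by (simp add: algebra_simps)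
    with root have "M $$ (1, 0) * M $$ (0, 1) + M $$ (1, 1) * (e - M $$ (0, 0)) = e * (e - M $$ (0, 0))"
      by linarith
    moreover have "M $$ (0, 0) * M $$ (0, 1) + M $$ (0, 1) * (e - M $$ (0, 0)) = e * M $$ (0, 1)"
      by (simp add: algebra_simps)
    moreover have "M $$ (0, 1) \<noteq> 0 \<or> e - M $$ (0, 0) \<noteq> 0"
      using 1 by simp
    ultimately show ?thesis
      using ev by blast
  next
    case 2
    have "M $$ (0, 0) * (e - M $$ (1, 1)) + M $$ (0, 1) * M $$ (1, 0) - e * (e - M $$ (1, 1))
        = M $$ (0, 1) * M $$ (1, 0) - (M $$ (0, 0) - e) * (M $$ (1, 1) - e)"
      by (simp add: algebra_simps)
    with root have "M $$ (0, 0) * (e - M $$ (1, 1)) + M $$ (0, 1) * M $$ (1, 0) = e * (e - M $$ (1, 1))"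
      by linarith
    moreover have "M $$ (1, 0) * (e - M $$ (1, 1)) + M $$ (1, 1) * M $$ (1, 0) = e * M $$ (1, 0)"
      by (simp add: algebra_simps)
    moreover have "e - M $$ (1, 1) \<noteq> 0 \<or> M $$ (1, 0) \<noteq> 0"
      using 2 by auto
    ultimately show ?thesis
      using ev by blast
  next
    case 3
    then show ?thesis
      by (intro ev[of 1 0]) simp_all
  qed
qed

text \<open>Serves to turn an upper bound on the spectral radius into inequalities between the
  entries of \<open>M\<close>.\<close>

lemma abs_root_le_real_spectral_radius_2:
  fixes M :: "real mat" and e :: real
  assumes "M \<in> carrier_mat 2 2"
    and "(M $$ (0, 0) - e) * (M $$ (1, 1) - e) = M $$ (0, 1) * M $$ (1, 0)"
  shows "\<bar>e\<bar> \<le> real_spectral_radius M"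
  using cmod_eigenvalue_le_real_spectral_radius[OF assms(1) _ eigenvalue_2I[OF assms]] by simp

section \<open>Weighted Euclidean norms\<close>

text \<open>For \<open>p, q > 0\<close> and \<open>s \<ge> 0\<close>: the operator norm of
  \<open>M\<close> induced by the norm \<open>sqrt (p x^2 + q y^2)\<close> is at most
  \<open>s\<close>. Squaring keeps the condition polynomial.\<close>

definition weighted_norm_le :: "real \<Rightarrow> real \<Rightarrow> real \<Rightarrow> real mat \<Rightarrow> bool" where
  "weighted_norm_le p q s M \<longleftrightarrow> (\<forall>x y.
     p * (M $$ (0, 0) * x + M $$ (0, 1) * y)\<^sup>2 + q * (M $$ (1, 0) * x + M $$ (1, 1) * y)\<^sup>2
       \<le> s\<^sup>2 * (p * x\<^sup>2 + q * y\<^sup>2))"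

lemma weighted_norm_le_mult:
  assumes MN: "M \<in> carrier_mat 2 2" "N \<in> carrier_mat 2 2"
    and M: "weighted_norm_le p q s M" and N: "weighted_norm_le p q t N"
  shows "weighted_norm_le p q (s * t) (M * N)"
  unfolding weighted_norm_le_def
proof (intro allI)
  fix x y :: real
  define u where "u = N $$ (0, 0) * x + N $$ (0, 1) * y"
  define v where "v = N $$ (1, 0) * x + N $$ (1, 1) * y"
  have "p * ((M * N) $$ (0, 0) * x + (M * N) $$ (0, 1) * y)\<^sup>2
      + q * ((M * N) $$ (1, 0) * x + (M * N) $$ (1, 1) * y)\<^sup>2
      = p * (M $$ (0, 0) * u + M $$ (0, 1) * v)\<^sup>2 + q * (M $$ (1, 0) * u + M $$ (1, 1) * v)\<^sup>2"
    using MN by (simp add: index_mult_mat_2 u_def v_def algebra_simps del: index_mult_mat)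
  also have "\<dots> \<le> s\<^sup>2 * (p * u\<^sup>2 + q * v\<^sup>2)"
    using M by (simp add: weighted_norm_le_def)
  also have "\<dots> \<le> s\<^sup>2 * (t\<^sup>2 * (p * x\<^sup>2 + q * y\<^sup>2))"
    using N by (intro mult_left_mono) (simp_all add: weighted_norm_le_def u_def v_def)
  finally show "p * ((M * N) $$ (0, 0) * x + (M * N) $$ (0, 1) * y)\<^sup>2
      + q * ((M * N) $$ (1, 0) * x + (M * N) $$ (1, 1) * y)\<^sup>2
      \<le> (s * t)\<^sup>2 * (p * x\<^sup>2 + q * y\<^sup>2)"
    by (simp add: power_mult_distrib mult.assoc)
qed

lemma weighted_norm_le_mat_products:
  assumes S: "S \<subseteq> carrier_mat 2 2" and gen: "\<And>M. M \<in> S \<Longrightarrow> weighted_norm_le p q r M"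
  shows "M \<in> mat_products 2 S n \<Longrightarrow> weighted_norm_le p q (r ^ n) M"
proof (induction n arbitrary: M)
  case 0
  then show ?case by (simp add: weighted_norm_le_def)
next
  case (Suc n)
  then obtain N P where "M = N * P" "N \<in> S" "P \<in> mat_products 2 S n"
    by (auto simp: mat_products_Suc)
  then show ?case
    using Suc.IH S mat_products_carrier[OF S] by (auto intro!: weighted_norm_le_mult gen)
qed

text \<open>An operator norm bounds every eigenvalue. The eigenvector may be complex while the norm
  concerns real vectors; as \<open>M\<close> is real, it acts on real and imaginary parts
  separately, and their squared norms add up.\<close>

lemma real_spectral_radius_le_weighted_norm:
  assumes M: "M \<in> carrier_mat 2 2" and pq: "p > 0" "q > 0" and "s \<ge> 0"
    and norm: "weighted_norm_le p q s M"
  shows "real_spectral_radius M \<le> s"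
proof -
  obtain e where e: "eigenvalue (map_mat complex_of_real M) e" "cmod e = real_spectral_radius M"
    using real_spectral_radius_attained[OF M] by auto
  from eigenvalue_2E[OF M e(1)] obtain x y :: complex where xy: "x \<noteq> 0 \<or> y \<noteq> 0"
    and ev: "M $$ (0, 0) * x + M $$ (0, 1) * y = e * x" "M $$ (1, 0) * x + M $$ (1, 1) * y = e * y" .
  let ?N = "p * (cmod x)\<^sup>2 + q * (cmod y)\<^sup>2"
  have pos: "?N > 0"
    using xy pq by (auto intro: add_pos_nonneg add_nonneg_pos)
  have "(cmod e)\<^sup>2 * ?N = p * (cmod (e * x))\<^sup>2 + q * (cmod (e * y))\<^sup>2"
    by (simp add: norm_mult power_mult_distrib algebra_simps)
  also have "\<dots> = (p * (M $$ (0, 0) * Re x + M $$ (0, 1) * Re y)\<^sup>2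
        + q * (M $$ (1, 0) * Re x + M $$ (1, 1) * Re y)\<^sup>2)
      + (p * (M $$ (0, 0) * Im x + M $$ (0, 1) * Im y)\<^sup>2
        + q * (M $$ (1, 0) * Im x + M $$ (1, 1) * Im y)\<^sup>2)"
    by (simp add: ev[symmetric] cmod_power2 distrib_left)
  also have "\<dots> \<le> s\<^sup>2 * (p * (Re x)\<^sup>2 + q * (Re y)\<^sup>2) + s\<^sup>2 * (p * (Im x)\<^sup>2 + q * (Im y)\<^sup>2)"
    using norm unfolding weighted_norm_le_def by (intro add_mono) blast+
  also have "\<dots> = s\<^sup>2 * ?N"
    by (simp add: cmod_power2 algebra_simps)
  finally have "(cmod e)\<^sup>2 \<le> s\<^sup>2"
    using pos by simp
  then show ?thesis
    using e(2) \<open>s \<ge> 0\<close> power2_le_imp_le by metis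
qed

section \<open>Triangular matrices\<close>

text \<open>The vanishing position \<open>(i, j)\<close> is left open so that upper and lower
  triangular matrices are treated at once.\<close>

lemma triangular_mat_products:
  fixes r :: real
  assumes S: "S \<subseteq> carrier_mat 2 2" and ij: "{i, j} = {0, 1}"
    and gen: "\<And>M. M \<in> S \<Longrightarrow> M $$ (i, j) = 0 \<and> \<bar>M $$ (i, i)\<bar> \<le> r \<and> \<bar>M $$ (j, j)\<bar> \<le> r"
  shows "M \<in> mat_products 2 S n \<Longrightarrow>
    M $$ (i, j) = 0 \<and> \<bar>M $$ (i, i)\<bar> \<le> r ^ n \<and> \<bar>M $$ (j, j)\<bar> \<le> r ^ n"
proof (induction n arbitrary: M)
  case 0
  then show ?case using ij by (auto simp: doubleton_eq_iff)
next
  case (Suc n)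
  then obtain N P where NP: "M = N * P" "N \<in> S" "P \<in> mat_products 2 S n"
    by (auto simp: mat_products_Suc)
  have car: "N \<in> carrier_mat 2 2" "P \<in> carrier_mat 2 2"
    using NP S mat_products_carrier[OF S] by auto
  from gen[OF NP(2)] Suc.IH[OF NP(3)]
  have "\<bar>N $$ (i, i) * P $$ (i, i)\<bar> \<le> r * r ^ n" "\<bar>N $$ (j, j) * P $$ (j, j)\<bar> \<le> r * r ^ n"
    by (auto simp: abs_mult intro!: mult_mono)
  moreover have "M $$ (i, j) = 0" "M $$ (i, i) = N $$ (i, i) * P $$ (i, i)"
    "M $$ (j, j) = N $$ (j, j) * P $$ (j, j)"
    using ij gen[OF NP(2)] Suc.IH[OF NP(3)]
    by (auto simp: NP(1) index_mult_mat_2[OF car] doubleton_eq_iff simp del: index_mult_mat)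
  ultimately show ?case by simp
qed

lemma real_spectral_radius_triangular_le:
  assumes M: "M \<in> carrier_mat 2 2" and ij: "{i, j} = {0, 1}"
    and tri: "M $$ (i, j) = 0" and diag: "\<bar>M $$ (i, i)\<bar> \<le> s" "\<bar>M $$ (j, j)\<bar> \<le> s"
  shows "real_spectral_radius M \<le> s"
proof -
  obtain e where e: "eigenvalue (map_mat complex_of_real M) e" "cmod e = real_spectral_radius M"
    using real_spectral_radius_attained[OF M] by auto
  from eigenvalue_2E[OF M e(1)] obtain x y :: complex where "x \<noteq> 0 \<or> y \<noteq> 0"
    "M $$ (0, 0) * x + M $$ (0, 1) * y = e * x" "M $$ (1, 0) * x + M $$ (1, 1) * y = e * y" .
  \<comment> \<open>Row \<open>i\<close> of the eigenvector equation involves coordinate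
    \<open>i\<close> alone, so \<open>e\<close> is its diagonal entry unless that coordinate is 0;
    then coordinate \<open>j\<close> is nonzero and row \<open>j\<close> gives the other
    entry.\<close>
  then have "e = M $$ (i, i) \<or> e = M $$ (j, j)"
    using ij tri by (cases "x = 0"; cases "y = 0") (auto simp: doubleton_eq_iff)
  then show ?thesis
    using diag e(2) by auto
qed

section \<open>Matrices whose off-diagonal entries have a nonnegative product\<close>

text \<open>As \<open>m \<ge> 0\<close>, the eigenvalues \<open>(a + d + D) / 2\<close> and
  \<open>(a + d - D) / 2\<close> are real, so they lie between \<open>-r\<close> and
  \<open>r\<close>. Since \<open>D\<close> is at least the distance of \<open>a\<close> and
  \<open>d\<close>, they enclose both diagonal entries.\<close>

lemma symmetrizable_2_bounds:
  fixes r :: real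
  assumes M: "M \<in> carrier_mat 2 2" and bc: "M $$ (0, 1) * M $$ (1, 0) \<ge> 0"
    and r: "real_spectral_radius M \<le> r"
  defines "a \<equiv> M $$ (0, 0)" and "d \<equiv> M $$ (1, 1)" and "m \<equiv> M $$ (0, 1) * M $$ (1, 0)"
  shows "\<bar>a\<bar> \<le> r" and "\<bar>d\<bar> \<le> r" and "m \<le> (r - a) * (r - d)" and "m \<le> (r + a) * (r + d)"
proof -
  define D where "D = sqrt ((a - d)\<^sup>2 + 4 * m)"
  have m: "m \<ge> 0"
    using bc by (simp add: m_def)
  then have D2: "D\<^sup>2 = (a - d)\<^sup>2 + 4 * m"
    by (simp add: D_def)
  have "sqrt ((a - d)\<^sup>2) \<le> D"
    unfolding D_def using m by (intro real_sqrt_le_mono) simp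
  then have D: "\<bar>a - d\<bar> \<le> D"
    by simp
  have "\<bar>(a + d + D) / 2\<bar> \<le> r" "\<bar>(a + d - D) / 2\<bar> \<le> r"
  proof -
    have "(a - (a + d + D) / 2) * (d - (a + d + D) / 2) = m"
      "(a - (a + d - D) / 2) * (d - (a + d - D) / 2) = m"
      using D2 by (simp_all add: field_simps power2_eq_square)
    then show "\<bar>(a + d + D) / 2\<bar> \<le> r" "\<bar>(a + d - D) / 2\<bar> \<le> r"
      using abs_root_le_real_spectral_radius_2[OF M] r unfolding a_def d_def m_def by force+
  qed
  then have *: "a + d + D \<le> 2 * r" "- 2 * r \<le> a + d + D" "a + d - D \<le> 2 * r" "- 2 * r \<le> a + d - D"
    by (simp_all add: abs_le_iff)
  with D show "\<bar>a\<bar> \<le> r"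
    by linarith
  from * D show "\<bar>d\<bar> \<le> r"
    by linarith
  \<comment> \<open>Up to a factor 4, these products are the values of the characteristic polynomial
    at \<open>r\<close> and at \<open>-r\<close>, that is, the determinants of
    \<open>r I - M\<close> and \<open>r I + M\<close>.\<close>
  have "0 \<le> (2 * r - (a + d + D)) * (2 * r - (a + d - D))"
    "0 \<le> (2 * r + (a + d + D)) * (2 * r + (a + d - D))"
    using * by simp_all
  then show "m \<le> (r - a) * (r - d)" "m \<le> (r + a) * (r + d)"
    using D2 by (simp_all add: algebra_simps power2_eq_square)
qed

lemma binary_form_nonneg:
  fixes \<alpha> \<beta> \<gamma> x y :: real
  assumes "\<alpha> \<ge> 0" and "\<gamma> \<ge> 0" and disc: "\<beta>\<^sup>2 \<le> \<alpha> * \<gamma>"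
  shows "\<alpha> * x\<^sup>2 + 2 * \<beta> * x * y + \<gamma> * y\<^sup>2 \<ge> 0"
proof (cases "\<alpha> = 0")
  \<comment> \<open>Here \<open>disc\<close> forces \<open>\<beta> = 0\<close>.\<close>
  case True
  then show ?thesis
    using assms by simp
next
  case False
  have "\<alpha> * (\<alpha> * x\<^sup>2 + 2 * \<beta> * x * y + \<gamma> * y\<^sup>2) = (\<alpha> * x + \<beta> * y)\<^sup>2 + (\<alpha> * \<gamma> - \<beta>\<^sup>2) * y\<^sup>2"
    by (simp add: algebra_simps power2_eq_square)
  also have "\<dots> \<ge> 0"
    using disc by simp
  finally show ?thesis
    using False \<open>\<alpha> \<ge> 0\<close> by (simp add: zero_le_mult_iff)
qed

text \<open>By \<open>symm\<close>, \<open>M\<close> is self-adjoint for the inner product with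
  weights \<open>p\<close> and \<open>q\<close>. The entry bounds make \<open>r I + M\<close> and
  \<open>r I - M\<close> positive semidefinite, and from this the same follows for
  \<open>r^2 I - M^2\<close>, which is the norm bound.\<close>

lemma weighted_norm_le_symmetrizable:
  assumes M: "M \<in> carrier_mat 2 2" and pq: "p > 0" "q > 0"
    and symm: "p * M $$ (0, 1) = q * M $$ (1, 0)"
    and r: "real_spectral_radius M \<le> r"
  shows "weighted_norm_le p q r M"
proof -
  define a b c d where "a = M $$ (0, 0)" "b = M $$ (0, 1)" "c = M $$ (1, 0)" "d = M $$ (1, 1)"
  note defs = this
  have pb: "p * b = q * c"
    using symm by (simp add: defs)
  \<comment> \<open>Writing \<open>b = q t\<close> and \<open>c = p t\<close> builds
    \<open>symm\<close> into the variables, so that the long identity below becomes a plain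
    polynomial identity.\<close>
  define t where "t = b / q"
  have b: "b = q * t"
    using pq by (simp add: t_def)
  have c: "c = p * t"
    using pb pq by (simp add: t_def field_simps)
  have bc: "b * c \<ge> 0"
    using pq mult_nonneg_nonneg[of "p * q" "t\<^sup>2"] by (simp add: b c power2_eq_square mult_ac)
  note bounds = symmetrizable_2_bounds[OF M _ r, folded defs, OF bc]
  have "r \<ge> 0"
    using bounds(1) by linarith
  have pb2: "(p * b)\<^sup>2 = p * q * (b * c)"
    using pb by (simp add: power2_eq_square algebra_simps)
  \<comment> \<open>\<open>plus\<close> and \<open>minus\<close> are the quadratic forms of
    \<open>r I + M\<close> and \<open>r I - M\<close> in the weighted inner product; the two cross
    terms agree because \<open>p b = q c\<close>.\<close>
  have plus: "p * (r + a) * x\<^sup>2 + 2 * (p * b) * x * y + q * (r + d) * y\<^sup>2 \<ge> 0" for x y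
  proof (rule binary_form_nonneg)
    show "(p * b)\<^sup>2 \<le> p * (r + a) * (q * (r + d))"
      using mult_left_mono[OF bounds(4), of "p * q"] pq pb2 by (simp add: mult_ac)
  qed (use pq bounds(1,2) in auto)
  have minus: "p * (r - a) * x\<^sup>2 + 2 * (- (p * b)) * x * y + q * (r - d) * y\<^sup>2 \<ge> 0" for x y
  proof (rule binary_form_nonneg)
    show "(- (p * b))\<^sup>2 \<le> p * (r - a) * (q * (r - d))"
      using mult_left_mono[OF bounds(3), of "p * q"] pq pb2 by (simp add: mult_ac)
  qed (use pq bounds(1,2) in auto)
  have "0 \<le> r\<^sup>2 * (p * x\<^sup>2 + q * y\<^sup>2) - (p * (a * x + b * y)\<^sup>2 + q * (c * x + d * y)\<^sup>2)"
    (is "0 \<le> ?E") for x y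
  \<comment> \<open>The identity yields only \<open>2 r\<close> times the claim; for
    \<open>r = 0\<close> the bounds force \<open>M\<close> to be zero.\<close>
  proof (cases "r = 0")
    case True
    then have "a = 0" "d = 0" "b * c = 0"
      using bounds bc by auto
    then have "b = 0" "c = 0"
      using pb pq by auto
    with True \<open>a = 0\<close> \<open>d = 0\<close> show ?thesis
      by simp
  next
    case False
    \<comment> \<open>\<open>(u, v)\<close> is the image of \<open>(x, y)\<close> under
      \<open>r I - M\<close>, and \<open>(w, z)\<close> its image under \<open>r I + M\<close>. The
      first goes into \<open>plus\<close>, the second into \<open>minus\<close>.\<close>
    define u v w z where "u = (r - a) * x - b * y" "v = (r - d) * y - c * x"
      "w = (r + a) * x + b * y" "z = (r + d) * y + c * x"
    note uvwz = this
    \<comment> \<open>\<open>2 r (r\<^sup>2 - M\<^sup>2) = (r - M) (r + M) (r - M) + (r + M) (r - M) (r + M)\<close>\<close>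
    have "2 * r * ?E = (p * (r + a) * u\<^sup>2 + 2 * (p * b) * u * v + q * (r + d) * v\<^sup>2)
        + (p * (r - a) * w\<^sup>2 + 2 * (- (p * b)) * w * z + q * (r - d) * z\<^sup>2)"
      unfolding uvwz b c by (simp add: algebra_simps power2_eq_square)
    also have "\<dots> \<ge> 0"
      using plus minus by (rule add_nonneg_nonneg)
    finally show ?thesis
      using False \<open>r \<ge> 0\<close> by (simp add: zero_le_mult_iff)
  qed
  then show ?thesis
    unfolding weighted_norm_le_def defs[symmetric] by simp
qed

theorem corollary4:
  fixes l1 l2 a b c d :: real and A B :: "real mat"
  assumes "A = mat_of_rows_list 2 [[l1, 0], [0, l2]]"
    and "B = mat_of_rows_list 2 [[a, b], [c, d]]"
    and "b * c \<ge> 0"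
  shows "spectral_finiteness_property 2 {A, B}
      \<and> generalized_spectral_radius 2 {A, B} = 
          max (real_spectral_radius A) (real_spectral_radius B)"
proof -
  define r where "r = max (real_spectral_radius A) (real_spectral_radius B)"
  have A: "A \<in> carrier_mat 2 2" "A $$ (0, 0) = l1" "A $$ (0, 1) = 0" "A $$ (1, 0) = 0" "A $$ (1, 1) = l2"
    using assms(1) by (auto simp: mat_of_rows_list_def)
  have B: "B \<in> carrier_mat 2 2" "B $$ (0, 0) = a" "B $$ (0, 1) = b" "B $$ (1, 0) = c" "B $$ (1, 1) = d"
    using assms(2) by (auto simp: mat_of_rows_list_def)
  have rA: "real_spectral_radius A \<le> r" and rB: "real_spectral_radius B \<le> r"
    by (auto simp: r_def)
  have S: "{A, B} \<subseteq> carrier_mat 2 2"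
    using A B by simp
  \<comment> \<open>The off-diagonal product of \<open>A\<close> is 0, so the same lemma also bounds
    its diagonal entries by \<open>r\<close>.\<close>
  note boundsA = symmetrizable_2_bounds[OF A(1) _ rA, unfolded A, simplified]
  note boundsB = symmetrizable_2_bounds[OF B(1) _ rB, unfolded B, OF assms(3)]
  have "r \<ge> 0"
    using boundsB(1) by linarith
  have bound: "real_spectral_radius M \<le> r ^ n" if M: "M \<in> mat_products 2 {A, B} n" for M n
  proof (cases "b * c = 0")
    case True
    \<comment> \<open>\<open>A\<close> vanishes at both off-diagonal positions, so the one where
      \<open>B\<close> vanishes makes both matrices triangular of the same shape.\<close>
    then obtain i j :: nat where ij: "{i, j} = {0, 1}" and "B $$ (i, j) = 0"
      using B that by (metis insert_commute mult_eq_0_iff)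
    then have "N $$ (i, j) = 0 \<and> \<bar>N $$ (i, i)\<bar> \<le> r \<and> \<bar>N $$ (j, j)\<bar> \<le> r" if "N \<in> {A, B}" for N
      using that A B boundsA(1,2) boundsB(1,2) by (auto simp: doubleton_eq_iff)
    from triangular_mat_products[OF S ij this M] show ?thesis
      using real_spectral_radius_triangular_le[OF mat_products_carrier[OF S M] ij] by blast
  next
    case False
    \<comment> \<open>The weights are \<open>p = \<bar>c\<bar>\<close> and
      \<open>q = \<bar>b\<bar>\<close>: as \<open>b\<close> and \<open>c\<close> have the same sign,
      \<open>p b = q c\<close> holds for \<open>B\<close>, while for \<open>A\<close> it reads
      \<open>0 = 0\<close>.\<close>
    then have pos: "\<bar>c\<bar> > 0" "\<bar>b\<bar> > 0" and symm: "\<bar>c\<bar> * b = \<bar>b\<bar> * c"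
      using assms(3) by (auto simp: abs_if zero_le_mult_iff)
    have "weighted_norm_le \<bar>c\<bar> \<bar>b\<bar> r N" if "N \<in> {A, B}" for N
      using that weighted_norm_le_symmetrizable[OF A(1) pos _ rA]
        weighted_norm_le_symmetrizable[OF B(1) pos _ rB] symm A B by auto
    from weighted_norm_le_mat_products[OF S this M] show ?thesis
      using pos \<open>r \<ge> 0\<close>
      by (intro real_spectral_radius_le_weighted_norm[OF mat_products_carrier[OF S M]]) auto
  qed
  obtain G where G: "G \<in> {A, B}" "real_spectral_radius G = r"
    unfolding r_def by (metis insertCI max_def)
  have "finite {A, B}" by simp
  from spectral_finiteness_at_generator[OF this S G(1), unfolded G(2), OF \<open>r \<ge> 0\<close> bound]
  show ?thesis
    by (simp add: r_def)
qed

end
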